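(* Let $X_1,\ldots,X_l$ be independent random variables and let $E_1,\ldots,E_m$ be events, each $E_j$ depending only on the variables in its scope $\mathrm{sc}(E_j)$, with $\Pr[E_j]=p_j\in(0,1)$ for $j=1,\ldots,m$ and $\bar p=(p_1,\ldots,p_m)$. Let $G$ be the undirected graph on $\{1,\ldots,m\}$ in which $\{i,j\}$, $i\ne j$, is an edge if and only if $E_j$ is $d$-dependent on $E_i$ or $E_i$ is $d$-dependent on $E_j$, and let $I(G)$ be the set of independent sets of $G$. If for all $I\in I(G)$ $$q_I(G,\bar{p}):=\sum_{J\in I(G):\ I\subseteq J} (-1)^{|J\setminus I|}\prod_{j\in J} p_j> 0,$$ then $$\Pr\Big[\bigwedge_{j=1}^m\overline{E}_j\Big]>0.$$
   Context: Variable framework: the probability space is the product space of independent random variables $X_1,\ldots,X_l$; each event $E_j$ is determined by the values of a subset $\mathrm{sc}(E_j)$ of these variables, called its scope. $\overline{E}$ denotes the complement of $E$. $d$-dependency: $E_i$ is $d$-dependent on $E_j$ if there exists an assignment $\alpha$ of values to $X_1,\ldots,X_l$ under which $E_j$ occurs and $E_i$ does not, and such that the values of the variables in $\mathrm{sc}(E_j)$ can be changed (all other values of $\alpha$ being kept) so that $E_i$ occurs and $E_j$ ceases occurring. An independent set of $G$ is a set of vertices with no edges between them (the empty set included). *)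

theory Defs
  imports "HOL-Probability.Probability" "HOL-Library.Ramsey"
begin

text \<open>
  An assignment of values to the variables with index set \<open>L\<close>, the \<open>k\<close>-th one having value space
  \<open>N k\<close>, is a point of the product space \<^term>\<open>PiM L N\<close>, and an event of the variable framework is
  a measurable set of assignments.  A function on \<open>L\<close> is the value \<open>undefined\<close> outside \<open>L\<close>, so
  assignments can only differ on indices in \<open>L\<close>.
\<close>

definition determined_by :: "('i \<Rightarrow> 'b) set \<Rightarrow> 'i set \<Rightarrow> ('i \<Rightarrow> 'b) set \<Rightarrow> bool" where
  "determined_by \<Omega> S A \<longleftrightarrow>
     (\<forall>\<alpha>\<in>\<Omega>. \<forall>\<beta>\<in>\<Omega>. (\<forall>k\<in>S. \<alpha> k = \<beta> k) \<longrightarrow> (\<alpha> \<in> A \<longleftrightarrow> \<beta> \<in> A))"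

text \<open>
  The event, in the probability space \<open>M\<close> on which the variables live, that the joint value of the
  random variables \<open>X k\<close> (\<open>k \<in> L\<close>) lies in the set \<open>A\<close> of assignments.
\<close>

definition occurs :: "'a measure \<Rightarrow> ('i \<Rightarrow> 'a \<Rightarrow> 'b) \<Rightarrow> 'i set \<Rightarrow> ('i \<Rightarrow> 'b) set \<Rightarrow> 'a set" where
  "occurs M X L A = {\<omega> \<in> space M. (\<lambda>k\<in>L. X k \<omega>) \<in> A}"

text \<open>
  \<open>d_dependent \<Omega> sc E i j\<close> reads: \<open>E i\<close> is d-dependent on \<open>E j\<close>.  The relation is directed, and it
  is the scope of \<open>E j\<close> whose variables are changed.
\<close>

definition d_dependent ::
    "('i \<Rightarrow> 'b) set \<Rightarrow> ('e \<Rightarrow> 'i set) \<Rightarrow> ('e \<Rightarrow> ('i \<Rightarrow> 'b) set) \<Rightarrow> 'e \<Rightarrow> 'e \<Rightarrow> bool" where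
  "d_dependent \<Omega> sc E i j \<longleftrightarrow>
     (\<exists>\<alpha>\<in>\<Omega>. \<alpha> \<in> E j \<and> \<alpha> \<notin> E i \<and>
        (\<exists>\<beta>\<in>\<Omega>. (\<forall>k. k \<notin> sc j \<longrightarrow> \<beta> k = \<alpha> k) \<and> \<beta> \<in> E i \<and> \<beta> \<notin> E j))"

definition d_dependency_edges ::
    "('i \<Rightarrow> 'b) set \<Rightarrow> ('e \<Rightarrow> 'i set) \<Rightarrow> ('e \<Rightarrow> ('i \<Rightarrow> 'b) set) \<Rightarrow> 'e set \<Rightarrow> 'e set set" where
  "d_dependency_edges \<Omega> sc E V =
     {{i, j} | i j. i \<in> V \<and> j \<in> V \<and> i \<noteq> j \<and>
                    (d_dependent \<Omega> sc E j i \<or> d_dependent \<Omega> sc E i j)}"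

definition independent_sets :: "'e set \<Rightarrow> 'e set set \<Rightarrow> 'e set set" where
  "independent_sets V G = {I. I \<subseteq> V \<and> indep I G}"

definition shearer_q :: "'e set \<Rightarrow> 'e set set \<Rightarrow> ('e \<Rightarrow> real) \<Rightarrow> 'e set \<Rightarrow> real" where
  "shearer_q V G p I =
     (\<Sum>J\<in>{J \<in> independent_sets V G. I \<subseteq> J}. (-1) ^ card (J - I) * (\<Prod>j\<in>J. p j))"

end

theory Submission
  imports Defs
begin

text \<open>
  If neither of \<open>E i\<close> and \<open>E j\<close> is d-dependent on the other, then, once the variables outside
  \<open>sc i\<close> are fixed, the section of \<open>E j\<close> either contains or is contained in that of \<open>E i\<close>.  So in
  each fibre, the event \<open>B\<close> that none of a set of non-neighbours of \<open>i\<close> occurs is either disjoint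
  from \<open>E i\<close> or contains its complement.  In both cases \<open>E i\<close> and \<open>B\<close> are negatively correlated,
  and since the fibre probability of \<open>E i\<close> is constant, integration gives
  \<open>Pr (E i \<inter> B) \<le> p i * Pr B\<close>.  This is the lopsided dependency condition, and the usual induction
  for Shearer's lemma compares \<open>Pr (\<Inter>j\<in>S. - E j)\<close> with the independence polynomial of \<open>S\<close> at \<open>-p\<close>.
\<close>

section \<open>The independence polynomial\<close>

text \<open>The multivariate independence polynomial of the graph induced on \<open>S\<close>,
  evaluated at \<open>-p\<close>; it equals \<open>shearer_q S G p {}\<close>.\<close>

definition indep_poly :: "'e set set \<Rightarrow> ('e \<Rightarrow> real) \<Rightarrow> 'e set \<Rightarrow> real" where
  "indep_poly G p S = (\<Sum>J\<in>independent_sets S G. (-1) ^ card J * (\<Prod>j\<in>J. p j))"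

lemma finite_independent_sets: "finite V \<Longrightarrow> finite (independent_sets V G)"
  unfolding independent_sets_def by (rule finite_subset[of _ "Pow V"]) auto

lemma indep_poly_empty: "indep_poly G p {} = 1"
proof -
  have "independent_sets {} G = {{}}"
    by (auto simp: independent_sets_def)
  then show ?thesis
    by (simp add: indep_poly_def)
qed

lemma independent_sets_insert:
  assumes "i \<notin> S"
  shows "independent_sets (insert i S) G =
    independent_sets S G \<union> insert i ` independent_sets {j \<in> S. {i, j} \<notin> G} G"
proof (intro subset_antisym subsetI)
  fix J assume J: "J \<in> independent_sets (insert i S) G"
  show "J \<in> independent_sets S G \<union> insert i ` independent_sets {j \<in> S. {i, j} \<notin> G} G"
  proof (cases "i \<in> J")
    case True
    have "J - {i} \<in> independent_sets {j \<in> S. {i, j} \<notin> G} G"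
      using J True by (auto simp: independent_sets_def indep_def)
    moreover have "J = insert i (J - {i})"
      using True by auto
    ultimately show ?thesis by blast
  next
    case False
    then show ?thesis
      using J by (auto simp: independent_sets_def)
  qed
next
  fix J assume "J \<in> independent_sets S G \<union> insert i ` independent_sets {j \<in> S. {i, j} \<notin> G} G"
  then show "J \<in> independent_sets (insert i S) G"
    by (auto simp: independent_sets_def indep_def insert_commute)
qed

text \<open>Deletion recurrence: independent sets containing \<open>i\<close> come from independent
  sets of non-neighbours of \<open>i\<close> and carry an extra factor \<open>- p i\<close>.\<close>

lemma indep_poly_insert:
  assumes "finite S" "i \<notin> S"
  shows "indep_poly G p (insert i S) =
    indep_poly G p S - p i * indep_poly G p {j \<in> S. {i, j} \<notin> G}"
proof -
  let ?N = "{j \<in> S. {i, j} \<notin> G}"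
  let ?f = "\<lambda>J. (-1) ^ card J * (\<Prod>j\<in>J. p j)"
  have notin: "i \<notin> J" "finite J" if "J \<in> independent_sets ?N G" for J
    using that assms by (auto simp: independent_sets_def intro: finite_subset)
  have inj: "inj_on (insert i) (independent_sets ?N G)"
    using notin(1) by (intro inj_onI) (simp add: insert_ident)
  have disj: "independent_sets S G \<inter> insert i ` independent_sets ?N G = {}"
    using assms by (auto simp: independent_sets_def)
  have "indep_poly G p (insert i S) =
      sum ?f (independent_sets S G) + sum ?f (insert i ` independent_sets ?N G)"
    unfolding indep_poly_def independent_sets_insert[OF assms(2)]
    using assms disj by (intro sum.union_disjoint finite_imageI finite_independent_sets) auto
  also have "sum ?f (insert i ` independent_sets ?N G) =
      (\<Sum>J\<in>independent_sets ?N G. - p i * ?f J)"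
    using notin by (simp add: sum.reindex[OF inj] mult.left_commute)
  finally show ?thesis
    by (simp add: indep_poly_def sum_distrib_left sum_negf)
qed

text \<open>Expansion of the product of \<open>1 - 1\<close> over \<open>A\<close>; it drives the
  cancellation in the next lemma.\<close>

lemma sum_sign_Pow:
  assumes "finite A"
  shows "(\<Sum>I\<in>Pow A. (-1) ^ card I) = (if A = {} then 1 else 0 :: real)"
  using prod_diff_conv_sum[of A "\<lambda>_. 1 :: real" "\<lambda>_. 1"] assms
  by (auto simp: power_0_left)

text \<open>After exchanging the sums, \<open>J\<close> is weighted by the alternating sum over all
  subsets of \<open>J - S\<close>, which vanishes unless \<open>J \<subseteq> S\<close>.
  Intuitively, if \<open>shearer_q V G p I\<close> were the probability that exactly the events in
  \<open>I\<close> occur, the total would be the probability of avoiding all events in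
  \<open>S\<close>.\<close>

lemma indep_poly_eq_sum_shearer_q:
  fixes V :: "'e set"
  assumes "finite V" "S \<subseteq> V"
  shows "indep_poly G p S = (\<Sum>I\<in>independent_sets (V - S) G. shearer_q V G p I)"
proof -
  have sign: "(-1 :: real) ^ card (J - I) = (-1) ^ card J * (-1) ^ card I"
    if "I \<subseteq> J" "finite J" for I J :: "'e set"
  proof -
    have "card J = card (J - I) + card I"
      using that by (metis card_Diff_subset card_mono finite_subset le_add_diff_inverse2)
    then show ?thesis
      by (simp add: power_add flip: power_mult_distrib)
  qed
  have "(\<Sum>I\<in>independent_sets (V - S) G. shearer_q V G p I) =
      (\<Sum>J\<in>independent_sets V G. \<Sum>I\<in>{I \<in> independent_sets (V - S) G. I \<subseteq> J}.
        (-1) ^ card (J - I) * (\<Prod>j\<in>J. p j))"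
    unfolding shearer_q_def
    using assms by (intro sum.swap_restrict finite_independent_sets) auto
  also have "\<dots> = (\<Sum>J\<in>independent_sets V G.
      if J \<subseteq> S then (-1) ^ card J * (\<Prod>j\<in>J. p j) else 0)"
  proof (intro sum.cong refl)
    fix J assume J: "J \<in> independent_sets V G"
    then have fin: "finite J"
      using assms by (auto simp: independent_sets_def intro: finite_subset)
    \<comment> \<open>Subsets of \<open>J\<close> inherit its independence, so the only remaining
      constraint on \<open>I\<close> is to avoid \<open>S\<close>.\<close>
    have "{I \<in> independent_sets (V - S) G. I \<subseteq> J} = Pow (J - S)"
      using J by (auto simp: independent_sets_def indep_def)
    then have "(\<Sum>I\<in>{I \<in> independent_sets (V - S) G. I \<subseteq> J}.
          (-1) ^ card (J - I) * (\<Prod>j\<in>J. p j)) =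
        (\<Sum>I\<in>Pow (J - S). (-1) ^ card J * (\<Prod>j\<in>J. p j) * (-1) ^ card I)"
    proof (intro sum.cong)
      fix I assume "I \<in> Pow (J - S)"
      then have "I \<subseteq> J"
        by auto
      then show "(-1) ^ card (J - I) * (\<Prod>j\<in>J. p j) =
          (-1) ^ card J * (\<Prod>j\<in>J. p j) * (-1) ^ card I"
        using fin by (simp add: sign)
    qed
    also have "\<dots> = (-1) ^ card J * (\<Prod>j\<in>J. p j) * (if J - S = {} then 1 else 0)"
      using fin by (simp only: sum_sign_Pow finite_Diff flip: sum_distrib_left)
    finally show "(\<Sum>I\<in>{I \<in> independent_sets (V - S) G. I \<subseteq> J}.
          (-1) ^ card (J - I) * (\<Prod>j\<in>J. p j)) =
        (if J \<subseteq> S then (-1) ^ card J * (\<Prod>j\<in>J. p j) else 0)"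
      by auto
  qed
  also have "\<dots> = (\<Sum>J\<in>{J \<in> independent_sets V G. J \<subseteq> S}. (-1) ^ card J * (\<Prod>j\<in>J. p j))"
    using assms by (simp add: sum.inter_filter finite_independent_sets)
  also have "{J \<in> independent_sets V G. J \<subseteq> S} = independent_sets S G"
    using assms by (auto simp: independent_sets_def)
  finally show ?thesis
    by (simp add: indep_poly_def)
qed

text \<open>The induction below needs positivity on every subset of \<open>V\<close>. The preceding
  identity gives a sum of positive terms, and the empty set ensures that there is at least one
  term.\<close>

lemma indep_poly_pos:
  assumes "finite V" "S \<subseteq> V"
    and "\<And>I. I \<in> independent_sets V G \<Longrightarrow> 0 < shearer_q V G p I"
  shows "0 < indep_poly G p S"
proof -
  have "{} \<in> independent_sets (V - S) G"
    by (simp add: independent_sets_def)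
  then show ?thesis
    unfolding indep_poly_eq_sum_shearer_q[OF assms(1,2)]
    using assms by (intro sum_pos finite_independent_sets) (auto simp: independent_sets_def)
qed

section \<open>The lopsided form of Shearer's lemma\<close>

text \<open>The quotient of the avoidance probability by \<open>indep_poly\<close> can only grow
  with the set of events and is 1 at the empty set. Hence the probability is at least
  \<open>indep_poly G p V\<close>.\<close>

lemma (in prob_space) lopsided_shearer:
  fixes V :: "'e set"
  assumes "finite V" and events: "\<And>j. j \<in> V \<Longrightarrow> E j \<in> events"
    and q: "\<And>I. I \<in> independent_sets V G \<Longrightarrow> 0 < shearer_q V G p I"
    and p: "\<And>j. j \<in> V \<Longrightarrow> 0 \<le> p j"
    and lopsided: "\<And>i T. \<lbrakk>i \<in> V; T \<subseteq> V; i \<notin> T; \<And>j. j \<in> T \<Longrightarrow> {i, j} \<notin> G\<rbrakk> \<Longrightarrow>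
      prob (E i \<inter> (space M - (\<Union>j\<in>T. E j))) \<le> p i * prob (space M - (\<Union>j\<in>T. E j))"
  shows "0 < prob (space M - (\<Union>j\<in>V. E j))"
proof -
  define P where "P S = prob (space M - (\<Union>j\<in>S. E j))" for S
  define Q where "Q = indep_poly G p"
  have Q_pos: "0 < Q S" if "S \<subseteq> V" for S
    unfolding Q_def using \<open>finite V\<close> that q by (rule indep_poly_pos)
  have ev: "(\<Union>j\<in>S. E j) \<in> events" if "S \<subseteq> V" for S
    using that \<open>finite V\<close> events by (intro sets.finite_UN) (auto intro: finite_subset)
  \<comment> \<open>Inserting \<open>i\<close> loses the part of the avoidance event inside
    \<open>E i\<close>. Forgetting the neighbours of \<open>i\<close> in \<open>S\<close> enlarges
    that part to an event that \<open>lopsided\<close> bounds.\<close>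
  have P_insert: "P S - p i * P {j \<in> S. {i, j} \<notin> G} \<le> P (insert i S)"
    if "insert i S \<subseteq> V" "i \<notin> S" for i S
  proof -
    let ?N = "{j \<in> S. {i, j} \<notin> G}"
    have meas: "E i \<in> events" "(\<Union>j\<in>S. E j) \<in> events" "(\<Union>j\<in>?N. E j) \<in> events"
      using that by (auto intro: events ev[of S] ev[of ?N])
    have "P S = prob ((space M - (\<Union>j\<in>insert i S. E j)) \<union> (E i \<inter> (space M - (\<Union>j\<in>S. E j))))"
      unfolding P_def using sets.sets_into_space[OF meas(1)] by (intro arg_cong[where f=prob]) auto
    also have "\<dots> = P (insert i S) + prob (E i \<inter> (space M - (\<Union>j\<in>S. E j)))"
      unfolding P_def using meas by (intro finite_measure_Union) auto
    also have "prob (E i \<inter> (space M - (\<Union>j\<in>S. E j))) \<le> prob (E i \<inter> (space M - (\<Union>j\<in>?N. E j)))"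
      using meas by (intro finite_measure_mono) auto
    also have "\<dots> \<le> p i * P ?N"
      unfolding P_def using that by (intro lopsided) auto
    finally show ?thesis by simp
  qed
  \<comment> \<open>Monotonicity of \<open>P / Q\<close>, cross-multiplied. Arbitrary
    \<open>T\<close> is allowed because the induction must compare \<open>S'\<close> with
    \<open>N\<close>, which may differ in many elements.\<close>
  have ratio: "P T * Q S \<le> P S * Q T" if "S \<subseteq> V" "T \<subseteq> S" for S T
    using finite_subset[OF that(1) \<open>finite V\<close>] that
  proof (induction S arbitrary: T rule: finite_psubset_induct)
    case (psubset S)
    show ?case
    proof (cases "T = S")
      case False
      then obtain i where i: "i \<in> S" "i \<notin> T"
        using psubset.prems by auto
      define S' where "S' = S - {i}"
      define N where "N = {j \<in> S'. {i, j} \<notin> G}"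
      have S: "S = insert i S'" "i \<notin> S'" and sub: "S' \<subset> S" "S' \<subseteq> V" "T \<subseteq> S'" "N \<subseteq> S'"
        and "finite S'"
        using i psubset.prems psubset.hyps by (auto simp: S'_def N_def)
      have IH: "P U * Q S' \<le> P S' * Q U" if "U \<subseteq> S'" for U
        using psubset.IH[OF sub(1,2) that] .
      have QS: "Q S = Q S' - p i * Q N"
        using indep_poly_insert[OF \<open>finite S'\<close> S(2), of G p] by (simp add: Q_def S(1) N_def)
      \<comment> \<open>The exact recurrence for \<open>Q\<close> meets the one-sided recurrence for
        \<open>P\<close>; the induction hypothesis for \<open>N\<close> exchanges
        \<open>P S' * Q N\<close> for \<open>P N * Q S'\<close>.\<close>
      have "P S' * Q S = P S' * Q S' - p i * (P S' * Q N)"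
        by (simp add: QS algebra_simps)
      also have "\<dots> \<le> P S' * Q S' - p i * (P N * Q S')"
        using IH[OF sub(4)] p[of i] psubset.prems i by (intro diff_left_mono mult_left_mono) auto
      also have "\<dots> = (P S' - p i * P N) * Q S'"
        by (simp add: algebra_simps)
      also have "\<dots> \<le> P S * Q S'"
        using P_insert[of i S'] Q_pos[of S'] sub psubset.prems S
        by (intro mult_right_mono) (auto simp: N_def)
      finally have step: "P S' * Q S \<le> P S * Q S'" .
      \<comment> \<open>The comparisons of \<open>T\<close> with \<open>S'\<close> and of
        \<open>S'\<close> with \<open>S\<close> are chained by carrying the positive factor
        \<open>Q S'\<close>, cancelled at the end.\<close>
      have "Q S' * (P T * Q S) = (P T * Q S') * Q S"
        by simp
      also have "\<dots> \<le> (P S' * Q T) * Q S"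
        using IH[OF sub(3)] Q_pos[of S] psubset.prems by (intro mult_right_mono) auto
      also have "\<dots> = (P S' * Q S) * Q T"
        by simp
      also have "\<dots> \<le> (P S * Q S') * Q T"
        using step Q_pos[OF order_trans[OF sub(3,2)]] by (intro mult_right_mono) auto
      also have "\<dots> = Q S' * (P S * Q T)"
        by simp
      finally show ?thesis
        using Q_pos[OF sub(2)] by simp
    qed simp
  qed
  have "P {} * Q V \<le> P V * Q {}"
    by (rule ratio) auto
  then have "Q V \<le> P V"
    by (simp add: P_def Q_def indep_poly_empty prob_space)
  then show ?thesis
    using Q_pos[of V] by (simp add: P_def)
qed

section \<open>Negative correlation by fibres\<close>

text \<open>In the second case put \<open>a = prob A\<close> and
  \<open>c = prob (A \<inter> B)\<close>. Then \<open>prob B = 1 - a + c\<close>, and the claim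
  becomes \<open>c * (1 - a) \<le> a * (1 - a)\<close>, which follows from
  \<open>c \<le> a\<close>.\<close>

lemma (in prob_space) prob_Int_le_times:
  assumes "A \<in> events" "B \<in> events" "A \<inter> B = {} \<or> space M - A \<subseteq> B"
  shows "prob (A \<inter> B) \<le> prob A * prob B"
  using assms(3)
proof
  assume "space M - A \<subseteq> B"
  then have "B = (space M - A) \<union> (A \<inter> B)"
    using assms sets.sets_into_space by auto
  then have "prob B = prob (space M - A) + prob (A \<inter> B)"
    using assms finite_measure_Union[of "space M - A" "A \<inter> B"] by auto
  then have B: "prob B = 1 - prob A + prob (A \<inter> B)"
    using assms by (simp add: prob_compl)
  have "prob (A \<inter> B) * (1 - prob A) \<le> prob A * (1 - prob A)"
    using assms by (intro mult_right_mono finite_measure_mono) auto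
  then show ?thesis
    by (simp add: B algebra_simps)
qed simp

text \<open>The alternative in \<open>fibre\<close> may vary with \<open>y\<close>, but the cylinder
  has the same section \<open>A\<close> in every fibre, so its probability leaves the integral as a
  constant.\<close>

lemma (in pair_prob_space) prob_Times_Int_le:
  assumes A: "A \<in> sets M1" and B: "B \<in> sets (M1 \<Otimes>\<^sub>M M2)"
    and fibre: "\<And>y. y \<in> space M2 \<Longrightarrow>
      (\<forall>x\<in>A. (x, y) \<notin> B) \<or> (\<forall>x\<in>space M1 - A. (x, y) \<in> B)"
  shows "measure (M1 \<Otimes>\<^sub>M M2) ((A \<times> space M2) \<inter> B) \<le> measure M1 A * measure (M1 \<Otimes>\<^sub>M M2) B"
proof -
  let ?s = "\<lambda>y. (\<lambda>x. (x, y)) -` B"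
  have sec: "?s y \<in> sets M1" for y
    using B by (rule sets_Pair2)
  have "emeasure (M1 \<Otimes>\<^sub>M M2) ((A \<times> space M2) \<inter> B) =
      (\<integral>\<^sup>+y. emeasure M1 ((\<lambda>x. (x, y)) -` ((A \<times> space M2) \<inter> B)) \<partial>M2)"
    using A B by (intro emeasure_pair_measure_alt2) auto
  also have "\<dots> \<le> (\<integral>\<^sup>+y. emeasure M1 A * emeasure M1 (?s y) \<partial>M2)"
  proof (rule nn_integral_mono)
    fix y assume y: "y \<in> space M2"
    have "M1.prob (A \<inter> ?s y) \<le> M1.prob A * M1.prob (?s y)"
      using fibre[OF y] by (intro M1.prob_Int_le_times A sec) auto
    moreover have "(\<lambda>x. (x, y)) -` ((A \<times> space M2) \<inter> B) = A \<inter> ?s y"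
      using y by auto
    ultimately show "emeasure M1 ((\<lambda>x. (x, y)) -` ((A \<times> space M2) \<inter> B))
        \<le> emeasure M1 A * emeasure M1 (?s y)"
      by (simp add: M1.emeasure_eq_measure flip: ennreal_mult)
  qed
  also have "\<dots> = emeasure M1 A * emeasure (M1 \<Otimes>\<^sub>M M2) B"
    using B by (simp add: emeasure_pair_measure_alt2 nn_integral_cmult measurable_emeasure_Pair2)
  finally show ?thesis
    by (simp add: M1.emeasure_eq_measure emeasure_eq_measure flip: ennreal_mult)
qed

text \<open>Splitting the coordinates into \<open>S\<close> and \<open>L - S\<close> turns
  \<open>A\<close> into a cylinder, while \<open>comp\<close> yields the fibre alternative for
  \<open>B\<close>.\<close>

lemma (in product_prob_space) prob_determined_by_Int_le:
  assumes "finite L" "S \<subseteq> L"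
    and A: "A \<in> sets (PiM L M)" and B: "B \<in> sets (PiM L M)"
    and det: "determined_by (space (PiM L M)) S A"
    and comp: "\<And>\<alpha> \<beta>. \<lbrakk>\<alpha> \<in> space (PiM L M); \<beta> \<in> space (PiM L M); \<And>k. k \<notin> S \<Longrightarrow> \<beta> k = \<alpha> k;
      \<alpha> \<in> A; \<alpha> \<in> B; \<beta> \<notin> A\<rbrakk> \<Longrightarrow> \<beta> \<in> B"
  shows "measure (PiM L M) (A \<inter> B) \<le> measure (PiM L M) A * measure (PiM L M) B"
proof -
  let ?T = "L - S"
  interpret S: prob_space "PiM S M"
    by (intro prob_space_PiM prob_space)
  interpret T: prob_space "PiM ?T M"
    by (intro prob_space_PiM prob_space)
  interpret ST: pair_prob_space "PiM S M" "PiM ?T M" ..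
  have L: "S \<union> ?T = L"
    using \<open>S \<subseteq> L\<close> by auto
  let ?D = "PiM S M \<Otimes>\<^sub>M PiM ?T M"
  let ?m = "merge S ?T"
  have m: "?m \<in> measurable ?D (PiM L M)"
    using measurable_merge[of S ?T M] unfolding L .
  have "distr ?D (PiM L M) ?m = PiM L M"
    using distr_merge[of S ?T, unfolded L] assms(1) finite_subset[OF assms(2,1)] by simp
  then have prob_eq: "measure (PiM L M) C = measure ?D (?m -` C \<inter> space ?D)"
    if "C \<in> sets (PiM L M)" for C
    using measure_distr[OF m that] by simp
  \<comment> \<open>Any base point serves: \<open>A\<close> is determined by \<open>S\<close>, so
    \<open>A'\<close> does not depend on it.\<close>
  obtain y0 where y0: "y0 \<in> space (PiM ?T M)"
    using T.not_empty by blast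
  have in_space: "?m (x, y) \<in> space (PiM L M)" if "x \<in> space (PiM S M)" "y \<in> space (PiM ?T M)" for x y
    using measurable_space[OF m] that by (simp add: space_pair_measure)
  define A' where "A' = (\<lambda>x. ?m (x, y0)) -` A \<inter> space (PiM S M)"
  have "(\<lambda>x. ?m (x, y0)) \<in> measurable (PiM S M) (PiM L M)"
    using measurable_compose[OF measurable_Pair2'[OF y0] m] by simp
  then have A': "A' \<in> sets (PiM S M)"
    unfolding A'_def using A by (rule measurable_sets)
  have A'_iff: "x \<in> A' \<longleftrightarrow> ?m (x, y) \<in> A"
    if "x \<in> space (PiM S M)" "y \<in> space (PiM ?T M)" for x y
  proof -
    have "?m (x, y0) \<in> A \<longleftrightarrow> ?m (x, y) \<in> A"
      using det[unfolded determined_by_def, rule_format, OF in_space[OF that(1) y0] in_space[OF that]]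
      by (simp add: merge_def)
    then show ?thesis
      using that by (simp add: A'_def)
  qed
  define B' where "B' = ?m -` B \<inter> space ?D"
  have B': "B' \<in> sets ?D"
    unfolding B'_def using m B by (rule measurable_sets)
  have mA: "?m -` A \<inter> space ?D = A' \<times> space (PiM ?T M)"
    using A'_iff sets.sets_into_space[OF A'] by (auto simp: space_pair_measure)
  have "measure (PiM L M) (A \<inter> B) = measure ?D ((A' \<times> space (PiM ?T M)) \<inter> B')"
    using A B by (simp add: prob_eq B'_def flip: mA) (auto intro: arg_cong[where f="measure ?D"])
  also have "\<dots> \<le> measure (PiM S M) A' * measure ?D B'"
  proof (rule ST.prob_Times_Int_le[OF A' B'])
    fix y assume y: "y \<in> space (PiM ?T M)"
    show "(\<forall>x\<in>A'. (x, y) \<notin> B') \<or> (\<forall>x\<in>space (PiM S M) - A'. (x, y) \<in> B')"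
    \<comment> \<open>If both alternatives fail, \<open>x\<close> lies in both sections and
      \<open>z\<close> in neither. Their merges with \<open>y\<close> differ only on
      \<open>S\<close>, so \<open>comp\<close> puts the second into \<open>B\<close>, a
      contradiction.\<close>
    proof (rule ccontr)
      assume "\<not> ?thesis"
      then obtain x z where x: "x \<in> A'" "(x, y) \<in> B'"
        and z: "z \<in> space (PiM S M)" "z \<notin> A'" "(z, y) \<notin> B'"
        by auto
      have x_space: "x \<in> space (PiM S M)"
        using x A' sets.sets_into_space by blast
      have "?m (z, y) \<in> B"
      proof (rule comp)
        show "?m (x, y) \<in> space (PiM L M)" "?m (z, y) \<in> space (PiM L M)"
          using in_space x_space z y by auto
        show "?m (x, y) \<in> A" "?m (z, y) \<notin> A"
          using A'_iff x_space x z y by auto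
        show "?m (x, y) \<in> B"
          using x by (simp add: B'_def)
      qed (simp add: merge_def)
      then show False
        using z y by (simp add: B'_def space_pair_measure)
    qed
  qed
  also have "measure (PiM S M) A' = measure ?D (A' \<times> space (PiM ?T M))"
    using A' by (simp add: measure_def T.emeasure_pair_measure_Times T.emeasure_space_1)
  also have "\<dots> = measure (PiM L M) A"
    using A by (simp add: prob_eq mA)
  also have "measure ?D B' = measure (PiM L M) B"
    using B by (simp add: prob_eq B'_def)
  finally show ?thesis .
qed

section \<open>Transfer to the joint distribution of the random variables\<close>

lemma (in prob_space) indep_vars_distr_eq_PiM:
  assumes "indep_vars M' X I"
  shows "distr M (PiM I M') (\<lambda>\<omega>. \<lambda>i\<in>I. X i \<omega>) = PiM I (\<lambda>i. distr M (M' i) (X i))"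
proof (cases "I = {}")
  \<comment> \<open>With no variables, both sides are the unique probability measure on a one-point
    space; this covers \<open>l = 0\<close>.\<close>
  case True
  show ?thesis
  proof (rule measure_eqI)
    fix C assume "C \<in> sets (distr M (PiM I M') (\<lambda>\<omega>. \<lambda>i\<in>I. X i \<omega>))"
    then have "C = {} \<or> C = {\<lambda>_. undefined}"
      using True by (auto simp: PiM_empty)
    then show "emeasure (distr M (PiM I M') (\<lambda>\<omega>. \<lambda>i\<in>I. X i \<omega>)) C =
        emeasure (PiM I (\<lambda>i. distr M (M' i) (X i))) C"
      using True by (auto simp: PiM_empty restrict_def emeasure_distr emeasure_space_1)
  qed (simp add: True PiM_empty)
next
  case False
  then show ?thesis
    using assms indep_vars_iff_distr_eq_PiM'[of I X M'] by (auto simp: indep_vars_def2)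
qed

lemma (in prob_space) prob_determined_by_Int_le:
  assumes X: "indep_vars N X L" and "finite L" "S \<subseteq> L"
    and A: "A \<in> sets (PiM L N)" and B: "B \<in> sets (PiM L N)"
    and det: "determined_by (space (PiM L N)) S A"
    and comp: "\<And>\<alpha> \<beta>. \<lbrakk>\<alpha> \<in> space (PiM L N); \<beta> \<in> space (PiM L N); \<And>k. k \<notin> S \<Longrightarrow> \<beta> k = \<alpha> k;
      \<alpha> \<in> A; \<alpha> \<in> B; \<beta> \<notin> A\<rbrakk> \<Longrightarrow> \<beta> \<in> B"
  defines "D \<equiv> distr M (PiM L N) (\<lambda>\<omega>. \<lambda>k\<in>L. X k \<omega>)"
  shows "measure D (A \<inter> B) \<le> measure D A * measure D B"
proof -
  have rv: "random_variable (N k) (X k)" if "k \<in> L" for k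
    using X that by (auto simp: indep_vars_def2)
  \<comment> \<open>\<open>product_prob_space\<close> requires a probability measure at every index,
    so a point mass fills the indices outside \<open>L\<close>.\<close>
  define N' where "N' k = (if k \<in> L then distr M (N k) (X k) else return (count_space UNIV) undefined)" for k
  have "prob_space (N' k)" for k
    using rv by (auto simp: N'_def intro: prob_space_distr prob_space_return)
  then interpret N': product_prob_space N' L
    by (rule product_prob_spaceI)
  have D: "D = PiM L N'"
    unfolding D_def indep_vars_distr_eq_PiM[OF X] by (rule PiM_cong) (auto simp: N'_def)
  have sets_eq: "sets (PiM L N') = sets (PiM L N)"
    by (rule sets_PiM_cong) (auto simp: N'_def)
  note space_eq = sets_eq_imp_space_eq[OF sets_eq]
  show ?thesis
    unfolding D
    using assms(2-3) A B det comp
    by (intro N'.prob_determined_by_Int_le) (auto simp: sets_eq space_eq)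
qed

section \<open>Shearer's condition for the d-dependency graph\<close>

theorem theorem2:
  fixes M :: "'a measure" and N :: "nat \<Rightarrow> 'b measure" and X :: "nat \<Rightarrow> 'a \<Rightarrow> 'b"
    and l m :: nat and E :: "nat \<Rightarrow> (nat \<Rightarrow> 'b) set" and sc :: "nat \<Rightarrow> nat set"
    and p :: "nat \<Rightarrow> real" and G :: "nat set set"
  assumes "prob_space M"
    and "prob_space.indep_vars M N X {1..l}"
    and "\<And>j. j \<in> {1..m} \<Longrightarrow> E j \<in> sets (PiM {1..l} N)"
    and "\<And>j. j \<in> {1..m} \<Longrightarrow> sc j \<subseteq> {1..l}"
    and "\<And>j. j \<in> {1..m} \<Longrightarrow> determined_by (space (PiM {1..l} N)) (sc j) (E j)"
    and "\<And>j. j \<in> {1..m} \<Longrightarrow> measure M (occurs M X {1..l} (E j)) = p j"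
    and "\<And>j. j \<in> {1..m} \<Longrightarrow> 0 < p j \<and> p j < 1"
    and "G = d_dependency_edges (space (PiM {1..l} N)) sc E {1..m}"
    and "\<And>I. I \<in> independent_sets {1..m} G \<Longrightarrow> shearer_q {1..m} G p I > 0"
  shows "measure M {\<omega> \<in> space M. \<forall>j\<in>{1..m}. \<omega> \<notin> occurs M X {1..l} (E j)} > 0"
proof -
  let ?L = "{1..l}" and ?V = "{1..m}"
  let ?\<Omega> = "space (PiM ?L N)" and ?Y = "\<lambda>\<omega>. \<lambda>k\<in>?L. X k \<omega>"
  interpret prob_space M by fact
  have Y: "?Y \<in> measurable M (PiM ?L N)"
    using assms(2) by (intro measurable_restrict) (auto simp: indep_vars_def2)
  \<comment> \<open>d-dependency speaks about assignments, so the argument runs on their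
    distribution and returns to \<open>M\<close> at the end.\<close>
  define D where "D = distr M (PiM ?L N) ?Y"
  interpret D: prob_space D
    unfolding D_def using Y by (rule prob_space_distr)
  have space_D: "space D = ?\<Omega>"
    by (simp add: D_def)
  have E_space: "E j \<subseteq> ?\<Omega>" if "j \<in> ?V" for j
    using assms(3)[OF that] by (rule sets.sets_into_space)
  have prob_E: "D.prob (E j) = p j" if "j \<in> ?V" for j
    using assms(3,6)[OF that] measure_distr[OF Y, of "E j"]
    by (simp add: D_def occurs_def vimage_def Int_def conj_commute)
  have "0 < D.prob (space D - (\<Union>j\<in>?V. E j))"
  proof (rule D.lopsided_shearer)
    fix i T assume i: "i \<in> ?V" and T: "T \<subseteq> ?V" "i \<notin> T" and G: "\<And>j. j \<in> T \<Longrightarrow> {i, j} \<notin> G"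
    have "finite T"
      using T by (auto intro: finite_subset)
    \<comment> \<open>In this direction the variables being changed are those of
      \<open>sc i\<close>, which determine \<open>E i\<close>.\<close>
    have not_dep: "\<not> d_dependent ?\<Omega> sc E j i" if "j \<in> T" for j
      using G[OF that] i T that unfolding assms(8) d_dependency_edges_def by blast
    have "D.prob (E i \<inter> (space D - (\<Union>j\<in>T. E j))) \<le>
        D.prob (E i) * D.prob (space D - (\<Union>j\<in>T. E j))"
      unfolding D_def
    proof (rule prob_determined_by_Int_le[OF assms(2) _ assms(4)[OF i] assms(3)[OF i] _ assms(5)[OF i]])
      show "space (distr M (PiM ?L N) ?Y) - (\<Union>j\<in>T. E j) \<in> sets (PiM ?L N)"
        using T \<open>finite T\<close> assms(3) by (auto intro!: sets.Diff sets.finite_UN)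
    next
      fix \<alpha> \<beta>
      assume "\<alpha> \<in> ?\<Omega>" "\<beta> \<in> ?\<Omega>" "\<And>k. k \<notin> sc i \<Longrightarrow> \<beta> k = \<alpha> k" "\<alpha> \<in> E i" "\<beta> \<notin> E i"
        "\<alpha> \<in> space (distr M (PiM ?L N) ?Y) - (\<Union>j\<in>T. E j)"
      \<comment> \<open>If \<beta> lay in some \<open>E j\<close>, the change from \<alpha> to
        \<beta> would witness that \<open>E j\<close> is d-dependent on \<open>E i\<close>.\<close>
      then show "\<beta> \<in> space (distr M (PiM ?L N) ?Y) - (\<Union>j\<in>T. E j)"
        using not_dep unfolding d_dependent_def space_distr by blast
    qed simp
    then show "D.prob (E i \<inter> (space D - (\<Union>j\<in>T. E j))) \<le> p i * D.prob (space D - (\<Union>j\<in>T. E j))"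
      by (simp add: prob_E[OF i])
  next
    show "E j \<in> D.events" if "j \<in> ?V" for j
      using assms(3)[OF that] by (simp add: D_def)
    show "0 \<le> p j" if "j \<in> ?V" for j
      using assms(7)[OF that] by simp
  qed (use assms(9) in auto)
  also have "D.prob (space D - (\<Union>j\<in>?V. E j)) =
      prob (?Y -` (?\<Omega> - (\<Union>j\<in>?V. E j)) \<inter> space M)"
    unfolding D_def space_distr using assms(3)
    by (intro measure_distr[OF Y] sets.Diff sets.finite_UN) auto
  also have "?Y -` (?\<Omega> - (\<Union>j\<in>?V. E j)) \<inter> space M =
      {\<omega> \<in> space M. \<forall>j\<in>?V. \<omega> \<notin> occurs M X ?L (E j)}"
    using measurable_space[OF Y] by (auto simp: occurs_def)
  finally show ?thesis .
qed

end
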